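(* Let $\mathbb{D}$ be a division ring and let $\Phi:\mathbb{Z}^{N+1}\to\mathbb{P}^M(\mathbb{D})$ be a Desargues map, with last variable $k=n_{N+1}$ distinguished and $n=(n_1,\dots,n_N)$. Let $\boldsymbol{\phi}_k(n)\in\mathbb{D}^{M+1}$ be homogeneous coordinates of $\Phi(n,k)$ in the gauge in which $$\boldsymbol{\phi}_{k+1}-\boldsymbol{\phi}_{k(i)}=\boldsymbol{\phi}_k u_{i,k},\qquad 1\le i\le N,\ k\in\mathbb{Z},$$ where the functions $u_{i,k}:\mathbb{Z}^N\to\mathbb{D}$ satisfy the compatibility conditions $u_{j,k}u_{i,k(j)}=u_{i,k}u_{j,k(i)}$ and $u_{i,k(j)}+u_{j,k+1}=u_{j,k(i)}+u_{i,k+1}$ for $i\ne j$, and let $r_k:\mathbb{Z}^N\to\mathbb{D}^\times$ be the potentials, $u_{i,k}=r_k^{-1}r_{k(i)}$. Suppose that $\Phi$ is periodic: $\Phi(n,k+K)=\Phi(n,k)$. Then there exist functions (monodromy factors) $\mu_k:\mathbb{Z}^N\to\mathbb{D}^\times$ such that $\boldsymbol{\phi}_{k+K}=\boldsymbol{\phi}_k\mu_k$; they satisfy $\mu_{k+1}=\mu_{k(i)}$ for $i=1,\dots,N$, and $u_{i,k+K}=\mu_k^{-1}u_{i,k}\mu_{k(i)}$, $r_{k+K}=r_k\mu_k$. Moreover: (1) The periodicity implies the linear system $$(\boldsymbol{\phi}_1,\boldsymbol{\phi}_2,\dots,\boldsymbol{\phi}_K)_{(i)}=(\boldsymbol{\phi}_1,\boldsymbol{\phi}_2,\dots,\boldsymbol{\phi}_K)\begin{pmatrix}-u_{i,1}&0&\cdots&0&\mu_1\\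 1&-u_{i,2}&0&\cdots&0\\ 0&1&\ddots&&\vdots\\ \vdots&&&-u_{i,K-1}&0\\ 0&0&\cdots&1&-u_{i,K}\end{pmatrix},\qquad 1\le i\le N,$$ where $\mu_1$ is a function of the variable $n_\sigma=n_1+\dots+n_N$. (2) The corresponding system of nonlinear equations takes the form, for $i\neq j$, $$(r_{k(j)}^{-1}-r_{k(i)}^{-1})\,r_{k(ij)} = r_{k+1}^{-1}(r_{k+1(i)}-r_{k+1(j)}),\quad k=1,\dots,K-1,$$ $$(r_{K(j)}^{-1}-r_{K(i)}^{-1})\,r_{K(ij)} = \mu_1^{-1}r_{1}^{-1}(r_{1(i)}-r_{1(j)})\,\mu_{1(\sigma)}.$$ (3) When $\mu_1$ is a constant from the center of $\mathbb{D}$, the system in (2) takes the form $(r_{k(j)}^{-1}-r_{k(i)}^{-1})r_{k(ij)} = r_{k+1}^{-1}(r_{k+1(i)}-r_{k+1(j)})$, $k=1,\dots,K$, $i\ne j$, with $k$ taken modulo $K$ (so the equation for $k=K$ has $r_1$ in place of $r_{K+1}$). In such a case, introducing a central parameter $\lambda$ by $\mu_1=(-\lambda)^K$ and defining $\boldsymbol{\psi}_k=(-\lambda)^{-k}(-1)^{n_\sigma}\boldsymbol{\phi}_k r_k^{-1}$, $k=1,\dots,K$, the linear problem in (1) is replaced by $$(\boldsymbol{\psi}_1,\dots,\boldsymbol{\psi}_K)_{(i)}=(\boldsymbol{\psi}_1,\dots,\boldsymbol{\psi}_K)\begin{pmatrix}1&0&\cdots&0&\lambda r_1r_{K(i)}^{-1}\\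 \lambda r_2r_{1(i)}^{-1}&1&0&\cdots&0\\ 0&\lambda r_3r_{2(i)}^{-1}&\ddots&&\vdots\\ \vdots&&&1&0\\ 0&0&\cdots&\lambda r_Kr_{K-1(i)}^{-1}&1\end{pmatrix},\qquad 1\le i\le N.$$
   Context: For a function $f$ on an integer lattice, $f_{(i)}$ denotes its translate in the variable $n_i\mapsto n_i+1$, and $f_{(ij)}=(f_{(i)})_{(j)}$. For a function $g$ of $n_\sigma=n_1+\dots+n_N$, $g_{(\sigma)}(n_\sigma)=g(n_\sigma+1)$. $\mathbb{D}^{M+1}$ is a right vector space over $\mathbb{D}$, and $\mathbb{D}^\times=\mathbb{D}\setminus\{0\}$. A Desargues map is a map $\Phi$ from an integer lattice to $\mathbb{P}^M(\mathbb{D})$ such that the points $\Phi(n)$, $\Phi_{(i)}(n)$, $\Phi_{(j)}(n)$ are collinear for all lattice points $n$ and all $i\neq j$.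
   Formalization: Φ(n,k+1)≠Φ(n,k) is assumed (for constant Φ the rule μ_{k+1}=μ_{k(i)} can fail). As potentials are fixed only up to left constants, r_{k+K}=r_kμ_k is shown up to a left constant c_k≠0 for any r, and exactly for some potentials equal to r_k for 1≤k≤K. *)

theory Defs
  imports "HOL-Analysis.Analysis"
begin

text \<open>The integer lattice is \<^typ>\<open>int ^ 'l\<close>, with variables indexed by the finite type
  \<^typ>\<open>'l\<close>.\<close>

definition shift :: "'l::finite \<Rightarrow> (int ^ 'l \<Rightarrow> 'a) \<Rightarrow> int ^ 'l \<Rightarrow> 'a" where
  "shift i f = (\<lambda>n. f (n + axis i 1))"

definition coord_sum :: "int ^ 'n::finite \<Rightarrow> int" where
  "coord_sum n = (\<Sum>i\<in>UNIV. n $ i)"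

text \<open>For \<^typ>\<open>'n\<close> of cardinality \<open>N\<close>, \<^typ>\<open>int ^ ('n::finite option)\<close> is the lattice of
  dimension \<open>N + 1\<close>; the index \<^term>\<open>None\<close> is that of the distinguished last variable.\<close>

definition with_last :: "int ^ 'n::finite \<Rightarrow> int \<Rightarrow> int ^ 'n option" where
  "with_last n k = (\<chi> l. case l of None \<Rightarrow> k | Some i \<Rightarrow> n $ i)"

text \<open>\<^typ>\<open>'d ^ 'm\<close> as a right vector space, \<open>CARD('m) = M + 1\<close>. The operation \<^term>\<open>(*s)\<close> of the
  library multiplies by scalars from the left.\<close>

definition rscale :: "'d::division_ring ^ 'm::finite \<Rightarrow> 'd \<Rightarrow> 'd ^ 'm" (infixl "\<cdot>\<^sub>r" 75) where
  "v \<cdot>\<^sub>r a = (\<chi> l. v $ l * a)"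

text \<open>Points and lines of the projective space are the right subspaces of dimension 1 and 2.\<close>

definition proj_point :: "'d::division_ring ^ 'm::finite \<Rightarrow> ('d ^ 'm) set" where
  "proj_point v = {v \<cdot>\<^sub>r a |a. True}"

definition proj_space :: "('d::division_ring ^ 'm::finite) set set" where
  "proj_space = {proj_point v |v. v \<noteq> 0}"

definition proj_lines :: "('d::division_ring ^ 'm::finite) set set" where
  "proj_lines = {{v \<cdot>\<^sub>r a + w \<cdot>\<^sub>r b |a b. True} |v w.
     \<forall>a b. v \<cdot>\<^sub>r a + w \<cdot>\<^sub>r b = 0 \<longrightarrow> a = 0 \<and> b = 0}"

definition proj_collinear ::
  "('d::division_ring ^ 'm::finite) set \<Rightarrow> ('d ^ 'm) set \<Rightarrow> ('d ^ 'm) set \<Rightarrow> bool" where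
  "proj_collinear P Q R \<longleftrightarrow> (\<exists>L\<in>proj_lines. P \<subseteq> L \<and> Q \<subseteq> L \<and> R \<subseteq> L)"

definition homogeneous_coords ::
  "'d::division_ring ^ 'm::finite \<Rightarrow> ('d ^ 'm) set \<Rightarrow> bool" where
  "homogeneous_coords v P \<longleftrightarrow> v \<noteq> 0 \<and> P = proj_point v"

definition desargues_map ::
  "(int ^ 'l::finite \<Rightarrow> ('d::division_ring ^ 'm::finite) set) \<Rightarrow> bool" where
  "desargues_map \<Phi> \<longleftrightarrow> (\<forall>n. \<Phi> n \<in> proj_space) \<and>
     (\<forall>n i j. i \<noteq> j \<longrightarrow> proj_collinear (\<Phi> n) (shift i \<Phi> n) (shift j \<Phi> n))"

text \<open>Functions with an index \<open>k\<close> take it before the lattice point: \<open>r k n\<close> is the value of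
  \<open>r\<^sub>k\<close> at \<open>n\<close>, and \<open>u i k n\<close> that of the function with indices \<open>i, k\<close>.\<close>

definition potentials ::
  "('n::finite \<Rightarrow> int \<Rightarrow> int ^ 'n \<Rightarrow> 'd::division_ring) \<Rightarrow> (int \<Rightarrow> int ^ 'n \<Rightarrow> 'd) \<Rightarrow> bool" where
  "potentials u r \<longleftrightarrow> (\<forall>k n. r k n \<noteq> 0) \<and>
     (\<forall>i k n. u i k n = inverse (r k n) * shift i (r k) n)"

definition monodromy_factors ::
  "int \<Rightarrow> (int \<Rightarrow> int ^ 'n::finite \<Rightarrow> 'd::division_ring ^ 'm::finite) \<Rightarrow>
   (int \<Rightarrow> int ^ 'n \<Rightarrow> 'd) \<Rightarrow> bool" where
  "monodromy_factors K \<phi> \<mu> \<longleftrightarrow> (\<forall>k n. \<mu> k n \<noteq> 0) \<and>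
     (\<forall>k n. \<phi> (k + K) n = \<phi> k n \<cdot>\<^sub>r \<mu> k n)"

definition ring_center :: "'d::ring_1 set" where
  "ring_center = {c. \<forall>x. c * x = x * c}"

text \<open>Square matrices of size \<open>K\<close> have rows and columns \<open>1, \<dots>, K\<close>; entries outside this range
  are irrelevant. The following is the entry \<open>b\<close> of the row of vectors
  \<open>(x\<^sub>1, \<dots>, x\<^sub>K)\<close> times the matrix \<open>A\<close>.\<close>

definition row_mult ::
  "int \<Rightarrow> (int \<Rightarrow> 'd::division_ring ^ 'm::finite) \<Rightarrow> (int \<Rightarrow> int \<Rightarrow> 'd) \<Rightarrow> int \<Rightarrow> 'd ^ 'm" where
  "row_mult K x A b = (\<Sum>a=1..K. x a \<cdot>\<^sub>r A a b)"

definition phi_matrix ::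
  "int \<Rightarrow> (int \<Rightarrow> 'd::division_ring) \<Rightarrow> 'd \<Rightarrow> int \<Rightarrow> int \<Rightarrow> 'd" where
  "phi_matrix K u m a b =
     (if a = b then - u b else 0) + (if a = b + 1 then 1 else 0) +
     (if a = 1 \<and> b = K then m else 0)"

text \<open>Below, \<open>s k\<close> stands for the translate \<open>r\<^sub>k\<^sub>(\<^sub>i\<^sub>)\<close> of \<open>r k\<close>.\<close>

definition psi_matrix ::
  "int \<Rightarrow> 'd::division_ring \<Rightarrow> (int \<Rightarrow> 'd) \<Rightarrow> (int \<Rightarrow> 'd) \<Rightarrow> int \<Rightarrow> int \<Rightarrow> 'd" where
  "psi_matrix K l r s a b =
     (if a = b then 1 else 0) + (if a = b + 1 then l * r a * inverse (s b) else 0) +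
     (if a = 1 \<and> b = K then l * r 1 * inverse (s K) else 0)"

definition cyc_next :: "int \<Rightarrow> int \<Rightarrow> int" where
  "cyc_next K k = (if k = K then 1 else k + 1)"

definition psi ::
  "'d::division_ring \<Rightarrow> (int \<Rightarrow> int ^ 'n::finite \<Rightarrow> 'd ^ 'm::finite) \<Rightarrow> (int \<Rightarrow> int ^ 'n \<Rightarrow> 'd) \<Rightarrow>
   int \<Rightarrow> int ^ 'n \<Rightarrow> 'd ^ 'm" where
  "psi l \<phi> r k n =
     ((- l) powi (- k) * (- 1) powi coord_sum n) *s (\<phi> k n \<cdot>\<^sub>r inverse (r k n))"

end

theory Submission
  imports Defs
begin

text \<open>Consecutive points of the periodic direction are distinct, so \<open>\<phi>\<^sub>k\<close> and \<open>\<phi>\<^sub>k\<^sub>+\<^sub>1\<close> are right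
  independent. Comparing the gauge relation at \<open>k + P\<close> with the one at \<open>k\<close>, for any period \<open>P\<close>,
  and separating coefficients gives the transformation rules of the monodromy factors. The
  potentials \<open>\<rho>\<close> that are quasi-periodic with factor exactly \<open>\<mu>\<close> arise from the same rules for all
  the periods \<open>m * K\<close> at once.\<close>

section \<open>Right scalar multiplication and projective points\<close>

lemma rscale_add_right: "v \<cdot>\<^sub>r (a + b) = v \<cdot>\<^sub>r a + v \<cdot>\<^sub>r b"
  by (simp add: rscale_def vec_eq_iff distrib_left)

lemma rscale_diff_left: "(v - w) \<cdot>\<^sub>r a = v \<cdot>\<^sub>r a - w \<cdot>\<^sub>r a"
  by (simp add: rscale_def vec_eq_iff left_diff_distrib)

lemma rscale_diff_right: "v \<cdot>\<^sub>r (a - b) = v \<cdot>\<^sub>r a - v \<cdot>\<^sub>r b"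
  by (simp add: rscale_def vec_eq_iff right_diff_distrib)

lemma rscale_minus_right: "v \<cdot>\<^sub>r (- a) = - (v \<cdot>\<^sub>r a)"
  by (simp add: rscale_def vec_eq_iff)

lemma rscale_rscale: "v \<cdot>\<^sub>r a \<cdot>\<^sub>r b = v \<cdot>\<^sub>r (a * b)"
  by (simp add: rscale_def vec_eq_iff mult.assoc)

lemma rscale_zero_right [simp]: "v \<cdot>\<^sub>r 0 = 0"
  by (simp add: rscale_def vec_eq_iff)

lemma rscale_one [simp]: "v \<cdot>\<^sub>r 1 = v"
  by (simp add: rscale_def vec_eq_iff)

lemma rscale_eq_0_iff: "v \<cdot>\<^sub>r a = 0 \<longleftrightarrow> v = 0 \<or> a = 0"
  by (auto simp: rscale_def vec_eq_iff)

lemma rscale_cancel: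
  assumes "v \<cdot>\<^sub>r a = v \<cdot>\<^sub>r b" "v \<noteq> 0"
  shows "a = b"
  using assms rscale_eq_0_iff[of v "a - b"] by (simp add: rscale_diff_right)

lemma mem_proj_point: "v \<in> proj_point v"
  unfolding proj_point_def by (rule CollectI, rule exI[of _ 1]) simp

lemma proj_point_subset: "proj_point (v \<cdot>\<^sub>r a) \<subseteq> proj_point v"
  by (auto simp: proj_point_def rscale_rscale)

lemma proj_point_rscale:
  assumes "a \<noteq> 0"
  shows "proj_point (v \<cdot>\<^sub>r a) = proj_point v"
  using proj_point_subset[of v a] proj_point_subset[of "v \<cdot>\<^sub>r a" "inverse a"] assms
  by (simp add: rscale_rscale)

text \<open>If one coefficient is nonzero, so is the other, since both vectors are nonzero; the two
  vectors then span the same point. This is how coefficients of consecutive vectors get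
  separated.\<close>

lemma rscale_eq_rscaleD:
  assumes "v \<cdot>\<^sub>r a = w \<cdot>\<^sub>r b" "v \<noteq> 0" "w \<noteq> 0" "proj_point v \<noteq> proj_point w"
  shows "a = 0 \<and> b = 0"
  using assms proj_point_rscale[of a v] proj_point_rscale[of b w]
    rscale_eq_0_iff[of v a] rscale_eq_0_iff[of w b]
  by metis

section \<open>Functions on the lattice tied to unit translations\<close>

text \<open>A unit translation in any variable is worth one unit of \<open>k\<close>, so all of
  \<open>n\<close> can be moved into the index, one coordinate after another.\<close>

lemma lattice_walk:
  fixes f :: "int \<Rightarrow> int ^ 'n::finite \<Rightarrow> 'a"
  assumes step: "\<And>i k n. f (k + 1) n = f k (n + axis i 1)"
  shows "f k n = f (k + coord_sum n) 0"
proof -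
  have axis_int: "axis i (m + 1) = axis i m + (axis i 1 :: int ^ 'n)" for i m
    by (simp add: axis_def vec_eq_iff)
  have walk1: "f k (n + axis i m) = f (k + m) n" for i m k n
  proof (induction m arbitrary: k rule: int_induct[of _ 0])
    case base
    have "axis i 0 = (0 :: int ^ 'n)" by (simp add: axis_def vec_eq_iff)
    then show ?case by (simp del: axis_eq_0_iff)
  next
    case (step1 m)
    have "f k (n + axis i (m + 1)) = f (k + 1) (n + axis i m)"
      by (simp add: axis_int step[of k _ i] add.assoc)
    then show ?case using step1 by (simp add: ac_simps)
  next
    case (step2 m)
    \<comment> \<open>Going down, the relation is read at index \<open>k - 1\<close>, where it
      supplies the unit missing from \<open>m - 1\<close>.\<close>
    have "f k (n + axis i (m - 1)) = f (k - 1 + 1) (n + axis i (m - 1))"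
      by simp
    also have "\<dots> = f (k - 1) (n + axis i m)"
      using axis_int[of i "m - 1"] by (subst step[of _ _ i]) (simp add: add.assoc)
    finally show ?case using step2(2)[of "k - 1"] by (simp add: algebra_simps)
  qed
  have walk: "f k (\<Sum>i\<in>A. axis i (n $ i)) = f (k + (\<Sum>i\<in>A. n $ i)) 0" if "finite A" for A k
    using that
  proof (induction A arbitrary: k rule: finite_induct)
    case (insert i A)
    have "f k (\<Sum>l\<in>insert i A. axis l (n $ l)) = f k ((\<Sum>l\<in>A. axis l (n $ l)) + axis i (n $ i))"
      using insert by (simp add: add.commute)
    then show ?case
      using insert by (simp add: walk1 add.assoc)
  qed simp
  have "n = (\<Sum>i\<in>UNIV. axis i (n $ i))"
    by (simp add: vec_eq_iff axis_def if_distrib cong: if_cong)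
  then show ?thesis
    using walk[of UNIV k] by (simp add: coord_sum_def)
qed

text \<open>This is \<open>lattice_walk\<close> for a family that does not vary with its
  index.\<close>

lemma shift_invariant_const:
  fixes f :: "int ^ 'n::finite \<Rightarrow> 'a"
  assumes "\<And>i n. f (n + axis i 1) = f n"
  shows "f n = f 0"
  using lattice_walk[of "\<lambda>_. f" 0 n] assms by simp

lemma coord_sum_axis: "coord_sum (n + axis i 1) = coord_sum n + 1"
  by (simp add: coord_sum_def axis_def sum.distrib)

section \<open>Cyclic matrices and central scalars\<close>

text \<open>Common to \<open>phi_matrix\<close> and \<open>psi_matrix\<close>. Beside the diagonal,
  column \<open>b\<close> contributes one more term: for \<open>b = K\<close> the row index
  \<open>b + 1\<close> is out of range and the corner takes over. For \<open>K = 1\<close> diagonal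
  and corner share their place and add up.\<close>

lemma row_mult_cyclic:
  assumes "b \<in> {1..K}"
  shows "row_mult K x (\<lambda>a b. (if a = b then p b else 0) + (if a = b + 1 then q a b else 0) +
      (if a = 1 \<and> b = K then m else 0)) b =
    x b \<cdot>\<^sub>r p b + (if b = K then x 1 \<cdot>\<^sub>r m else x (b + 1) \<cdot>\<^sub>r q (b + 1) b)"
proof -
  have "row_mult K x (\<lambda>a b. (if a = b then p b else 0) + (if a = b + 1 then q a b else 0) +
      (if a = 1 \<and> b = K then m else 0)) b =
    (\<Sum>a=1..K. if a = b then x a \<cdot>\<^sub>r p b else 0) +
    (\<Sum>a=1..K. if a = b + 1 then x a \<cdot>\<^sub>r q a b else 0) +
    (\<Sum>a=1..K. if a = 1 then (if b = K then x a \<cdot>\<^sub>r m else 0) else 0)"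
    unfolding row_mult_def sum.distrib[symmetric]
    by (rule sum.cong) (auto simp: rscale_add_right)
  then show ?thesis
    using assms by (simp add: sum.delta)
qed

lemma ring_centerD: "c \<in> ring_center \<Longrightarrow> x * c = c * x"
  by (simp add: ring_center_def)

lemma smult_rscale: "a *s (v \<cdot>\<^sub>r b) = (a *s v) \<cdot>\<^sub>r b"
  by (simp add: rscale_def vec_eq_iff mult.assoc)

lemma smult_center: "c \<in> ring_center \<Longrightarrow> c *s v = v \<cdot>\<^sub>r c"
  by (simp add: rscale_def vec_eq_iff ring_centerD)

section \<open>Monodromy factors and their transformation rules\<close>

lemma homogeneous_coords_factor:
  assumes "homogeneous_coords v P" "homogeneous_coords w P"
  obtains a where "a \<noteq> 0" "w = v \<cdot>\<^sub>r a"
proof -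
  have "w \<in> proj_point v"
    using assms mem_proj_point[of w] by (simp add: homogeneous_coords_def)
  then obtain a where "w = v \<cdot>\<^sub>r a"
    by (auto simp: proj_point_def)
  moreover have "w \<noteq> 0"
    using assms by (simp add: homogeneous_coords_def)
  ultimately show ?thesis
    using that[of a] by (simp add: rscale_eq_0_iff)
qed

text \<open>Each factor relates two coordinate vectors of the same point. The period
  \<open>P\<close> is any integer, so that all multiples \<open>m * K\<close> are covered.\<close>

lemma monodromy_factors_exist:
  assumes "\<And>n k. homogeneous_coords (\<phi> k n) (\<Phi> (with_last n k))"
    and "\<And>n k. \<Phi> (with_last n (k + P)) = \<Phi> (with_last n k)"
  shows "\<exists>\<mu>. monodromy_factors P \<phi> \<mu>"
proof -
  have "\<exists>a. a \<noteq> 0 \<and> \<phi> (k + P) n = \<phi> k n \<cdot>\<^sub>r a" for k n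
    using homogeneous_coords_factor[of "\<phi> k n" "\<Phi> (with_last n k)" "\<phi> (k + P) n"]
      assms(1)[of k n] assms(1)[of "k + P" n] assms(2)[of n k] by metis
  then show ?thesis
    unfolding monodromy_factors_def by metis
qed

lemma periodic_multiple:
  fixes f :: "int \<Rightarrow> 'a"
  assumes "\<And>k. f (k + K) = f k"
  shows "f (k + m * K) = f k"
proof (induction m rule: int_induct[of _ 0])
  case (step1 m)
  then show ?case using assms[of "k + m * K"] by (simp add: algebra_simps)
next
  case (step2 m)
  then show ?case using assms[of "k + (m - 1) * K"] by (simp add: algebra_simps)
qed simp

lemma monodromy_rules:
  fixes \<phi> :: "int \<Rightarrow> int ^ 'n::finite \<Rightarrow> 'd::division_ring ^ 'm::finite"
  assumes nz: "\<And>k n. \<phi> k n \<noteq> 0"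
    and indep: "\<And>k n. proj_point (\<phi> (k + 1) n) \<noteq> proj_point (\<phi> k n)"
    and gauge: "\<And>i k n. \<phi> (k + 1) n - shift i (\<phi> k) n = \<phi> k n \<cdot>\<^sub>r u i k n"
    and mono: "monodromy_factors P \<phi> \<mu>"
  shows "\<mu> (k + 1) n = shift i (\<mu> k) n"
    and "u i (k + P) n = inverse (\<mu> k n) * u i k n * shift i (\<mu> k) n"
proof -
  have \<mu>nz: "\<mu> k n \<noteq> 0" and \<mu>: "\<phi> (k + P) n = \<phi> k n \<cdot>\<^sub>r \<mu> k n" for k n
    using mono by (auto simp: monodromy_factors_def)
  let ?s = "shift i (\<mu> k) n"
  have s: "shift i (\<phi> k) n = \<phi> (k + 1) n - \<phi> k n \<cdot>\<^sub>r u i k n"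
    using gauge[of k n i] by (simp add: algebra_simps)
  have "shift i (\<phi> (k + P)) n = shift i (\<phi> k) n \<cdot>\<^sub>r ?s"
    by (simp add: shift_def \<mu>)
  moreover have "\<phi> (k + P + 1) n = \<phi> (k + 1) n \<cdot>\<^sub>r \<mu> (k + 1) n"
    using \<mu>[of "k + 1" n] by (simp add: ac_simps)
  \<comment> \<open>The gauge relation at \<open>k + P\<close>, with every vector expressed through
    \<open>\<phi> (k + 1) n\<close> and \<open>\<phi> k n\<close>.\<close>
  ultimately have
    "\<phi> (k + 1) n \<cdot>\<^sub>r \<mu> (k + 1) n - (\<phi> (k + 1) n - \<phi> k n \<cdot>\<^sub>r u i k n) \<cdot>\<^sub>r ?s =
      \<phi> k n \<cdot>\<^sub>r (\<mu> k n * u i (k + P) n)"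
    using gauge[of "k + P" n i] by (simp add: s \<mu> rscale_rscale)
  then have "\<phi> (k + 1) n \<cdot>\<^sub>r (\<mu> (k + 1) n - ?s) =
      \<phi> k n \<cdot>\<^sub>r (\<mu> k n * u i (k + P) n - u i k n * ?s)"
    by (simp add: rscale_diff_left rscale_diff_right rscale_rscale algebra_simps)
  \<comment> \<open>Both coefficients vanish: the left one gives the rule for \<open>\<mu>\<close>,
    the right one the rule for \<open>u\<close>.\<close>
  from rscale_eq_rscaleD[OF this nz nz indep]
  have "\<mu> (k + 1) n = ?s" and e: "\<mu> k n * u i (k + P) n = u i k n * ?s"
    by auto
  then show "\<mu> (k + 1) n = shift i (\<mu> k) n" by simp
  show "u i (k + P) n = inverse (\<mu> k n) * u i k n * ?s"
    using \<mu>nz[of k n] by (simp add: mult.assoc e[symmetric]) (simp add: mult.assoc[symmetric])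
qed

section \<open>Potentials and their normalisation\<close>

text \<open>The quotient of the two functions is invariant under translations, hence constant. The
  constant stands on the left, where it cancels in
  \<open>inverse (r n) * shift i r n\<close>.\<close>

lemma potentials_unique:
  fixes r s :: "int ^ 'n::finite \<Rightarrow> 'd::division_ring"
  assumes "\<And>n. r n \<noteq> 0" "\<And>n. s n \<noteq> 0"
    and "\<And>i n. inverse (r n) * shift i r n = inverse (s n) * shift i s n"
  shows "\<exists>c. c \<noteq> 0 \<and> (\<forall>n. r n = c * s n)"
proof -
  have "r (n + axis i 1) * inverse (s (n + axis i 1)) = r n * inverse (s n)" for i n
  proof -
    have "r (n + axis i 1) = r n * (inverse (r n) * shift i r n)"
      using assms(1) by (simp add: mult.assoc[symmetric] shift_def)
    also have "\<dots> = r n * inverse (s n) * s (n + axis i 1)"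
      unfolding assms(3) by (simp add: mult.assoc shift_def)
    finally show ?thesis using assms(2) by (simp add: mult.assoc)
  qed
  then have "r n * inverse (s n) = r 0 * inverse (s 0)" for n
    by (rule shift_invariant_const)
  then have "r n = r 0 * inverse (s 0) * s n" for n
    using assms(2) by (metis mult.assoc left_inverse mult.right_neutral)
  moreover have "r 0 * inverse (s 0) \<noteq> 0"
    using assms(1,2) by simp
  ultimately show ?thesis
    by blast
qed

text \<open>The functions \<open>u\<close> determine each \<open>r k\<close> only up to a left
  constant, so \<open>r\<close> itself need not be quasi-periodic. It is kept on the block
  \<open>{1..K}\<close> and carried to every other index by monodromy factors.\<close>

lemma quasi_periodic_potentials:
  fixes \<phi> :: "int \<Rightarrow> int ^ 'n::finite \<Rightarrow> 'd::division_ring ^ 'm::finite"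
  assumes nz: "\<And>k n. \<phi> k n \<noteq> 0"
    and indep: "\<And>k n. proj_point (\<phi> (k + 1) n) \<noteq> proj_point (\<phi> k n)"
    and gauge: "\<And>i k n. \<phi> (k + 1) n - shift i (\<phi> k) n = \<phi> k n \<cdot>\<^sub>r u i k n"
    and pot: "potentials u r"
    and mono: "monodromy_factors K \<phi> \<mu>"
    and multiples: "\<And>m. \<exists>\<nu>. monodromy_factors (m * K) \<phi> \<nu>"
    and "K \<ge> 1"
  obtains \<rho> where "potentials u \<rho>" "\<And>k. k \<in> {1..K} \<Longrightarrow> \<rho> k = r k"
    "\<And>k n. \<rho> (k + K) n = \<rho> k n * \<mu> k n"
proof -
  obtain \<nu> where \<nu>: "\<And>m. monodromy_factors (m * K) \<phi> (\<nu> m)"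
    using multiples by metis
  \<comment> \<open>\<open>j k\<close> is the representative of \<open>k\<close> in
    \<open>{1..K}\<close>, whence the offset by one, and \<open>q k\<close> is the number of periods
    from \<open>j k\<close> to \<open>k\<close>.\<close>
  define j where "j k = (k - 1) mod K + 1" for k
  define q where "q k = (k - 1) div K" for k
  define \<rho> where "\<rho> k n = r (j k) n * \<nu> (q k) (j k) n" for k n
  have k_eq: "j k + q k * K = k" for k
    by (simp add: j_def q_def)
  have j_add: "j (k + K) = j k" and q_add: "q (k + K) = q k + 1" for k
    using \<open>K \<ge> 1\<close> div_add_self2[of K "k - 1"] mod_add_self2[of "k - 1" K]
    by (simp_all add: j_def q_def algebra_simps)
  have rnz: "r k n \<noteq> 0" and ur: "u i k n = inverse (r k n) * shift i (r k) n" for i k n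
    using pot by (auto simp: potentials_def)
  have \<nu>nz: "\<nu> m k n \<noteq> 0" and \<nu>_eq: "\<phi> (k + m * K) n = \<phi> k n \<cdot>\<^sub>r \<nu> m k n" for m k n
    using \<nu>[of m] by (auto simp: monodromy_factors_def)
  \<comment> \<open>The rule for the period \<open>q k * K\<close>, read at \<open>j k\<close>,
    makes right multiplication by \<open>\<nu>\<close> yield potentials at \<open>k\<close>.\<close>
  have "u i k n = inverse (\<rho> k n) * shift i (\<rho> k) n" for i k n
    using monodromy_rules(2)[where u = u, OF nz indep gauge \<nu>[of "q k"], of i "j k" n]
      rnz[of "j k" n] \<nu>nz[of "q k" "j k" n]
    by (simp add: k_eq ur[of i "j k"] \<rho>_def shift_def nonzero_inverse_mult_distrib mult.assoc)
  then have 1: "potentials u \<rho>"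
    using rnz \<nu>nz by (auto simp: potentials_def \<rho>_def)
  have 2: "\<rho> k = r k" if "k \<in> {1..K}" for k
  proof
    fix n
    have "j k = k" "q k = 0"
      using that by (auto simp: j_def q_def)
    moreover have "\<nu> 0 k n = 1"
      using \<nu>_eq[of k 0 n] rscale_cancel[OF _ nz, of k n "\<nu> 0 k n" 1] by simp
    ultimately show "\<rho> k n = r k n"
      by (simp add: \<rho>_def)
  qed
  have 3: "\<rho> (k + K) n = \<rho> k n * \<mu> k n" for k n
  proof -
    \<comment> \<open>Two ways from \<open>\<phi> (j k) n\<close> to \<open>\<phi> (k + K) n\<close>
      are compared: in one leap, and through \<open>\<phi> k n\<close>.\<close>
    have "\<phi> (j k) n \<cdot>\<^sub>r \<nu> (q k + 1) (j k) n = \<phi> (k + K) n"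
      using \<nu>_eq[of "j k" "q k + 1" n] k_eq[of k] by (simp add: algebra_simps)
    also have "\<dots> = \<phi> k n \<cdot>\<^sub>r \<mu> k n"
      using mono by (simp add: monodromy_factors_def)
    also have "\<phi> k n = \<phi> (j k) n \<cdot>\<^sub>r \<nu> (q k) (j k) n"
      using \<nu>_eq[of "j k" "q k" n] by (simp add: k_eq)
    finally have "\<nu> (q k + 1) (j k) n = \<nu> (q k) (j k) n * \<mu> k n"
      using rscale_cancel[OF _ nz] by (simp add: rscale_rscale)
    then show ?thesis
      by (simp add: \<rho>_def j_add q_add mult.assoc)
  qed
  show ?thesis
    using that[OF 1 2 3] by blast
qed

section \<open>The gauge of \<open>psi\<close> and the nonlinear equations\<close>

text \<open>The sign \<open>(- 1) powi coord_sum n\<close> flips under translation, which turns the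
  coefficient of \<open>psi\<close> into 1; lowering the exponent of \<open>- l\<close> by one
  produces the factor \<open>l\<close>. The last term keeps \<open>\<phi> (k + 1) n\<close>, so that
  it can be wrapped around at \<open>k = K\<close>.\<close>

lemma psi_shift:
  assumes l: "l \<noteq> 0" "l \<in> ring_center"
    and r: "shift i (r k) n \<noteq> 0"
    and gauge: "\<phi> (k + 1) n - shift i (\<phi> k) n =
      \<phi> k n \<cdot>\<^sub>r (inverse (r k n) * shift i (r k) n)"
  shows "shift i (psi l \<phi> r k) n = psi l \<phi> r k n +
    (((- l) powi (- (k + 1)) * (- 1) powi coord_sum n) *s \<phi> (k + 1) n) \<cdot>\<^sub>r
      (l * inverse (shift i (r k) n))"
proof -
  define e where "e = (- l) powi (- k) * (- 1) powi coord_sum n"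
  define e' where "e' = (- l) powi (- (k + 1)) * (- 1) powi coord_sum n"
  have "(- l) powi (- k) = (- l) powi (- (k + 1)) * (- l)"
    using power_int_add[of "- l" "- (k + 1)" 1] l by simp
  then have e: "e = - (e' * l)"
    using ring_centerD[OF l(2)] by (simp add: e_def e'_def mult.assoc)
  have "shift i (psi l \<phi> r k) n = (- e) *s (shift i (\<phi> k) n \<cdot>\<^sub>r inverse (shift i (r k) n))"
    by (simp add: psi_def shift_def e_def coord_sum_axis power_int_add)
  also have "shift i (\<phi> k) n = \<phi> (k + 1) n - \<phi> k n \<cdot>\<^sub>r (inverse (r k n) * shift i (r k) n)"
    using gauge by (simp add: algebra_simps)
  also have "(- e) *s (\<dots> \<cdot>\<^sub>r inverse (shift i (r k) n)) =
      e *s (\<phi> k n \<cdot>\<^sub>r inverse (r k n)) +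
      (e' * l) *s (\<phi> (k + 1) n \<cdot>\<^sub>r inverse (shift i (r k) n))"
    using r by (simp add: e rscale_diff_left rscale_rscale mult.assoc)
      (simp add: vec_eq_iff rscale_def algebra_simps)
  also have "(e' * l) *s (\<phi> (k + 1) n \<cdot>\<^sub>r inverse (shift i (r k) n)) =
      (e' *s \<phi> (k + 1) n) \<cdot>\<^sub>r (l * inverse (shift i (r k) n))"
    using ring_centerD[OF l(2)]
    by (simp add: vec_eq_iff rscale_def mult.assoc) (simp add: mult.assoc[symmetric])
  finally show ?thesis
    by (simp add: psi_def e_def e'_def shift_def)
qed

text \<open>In terms of \<open>u\<close> the left side is
  \<open>shift j (u i k) n - shift i (u j k) n\<close>, to which additive compatibility applies. The
  right side stays in terms of \<open>u\<close>, because at \<open>k = K\<close> it is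
  \<open>u\<close> that wraps around.\<close>

lemma potential_equation:
  fixes r :: "int \<Rightarrow> int ^ 'n::finite \<Rightarrow> 'd::division_ring"
  assumes pot: "potentials u r"
    and add: "shift j (u i k) n + u j (k + 1) n = shift i (u j k) n + u i (k + 1) n"
  shows "(inverse (shift j (r k) n) - inverse (shift i (r k) n)) * shift j (shift i (r k)) n =
    u i (k + 1) n - u j (k + 1) n"
proof -
  have u: "u i k n = inverse (r k n) * shift i (r k) n" for i k n
    using pot by (auto simp: potentials_def)
  have "shift j (u i k) n = inverse (shift j (r k) n) * shift j (shift i (r k)) n"
    "shift i (u j k) n = inverse (shift i (r k) n) * shift j (shift i (r k)) n"
    by (simp_all add: shift_def u add.assoc add.commute[of "axis i 1"])
  then show ?thesis
    using add by (simp add: algebra_simps)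
qed

text \<open>The assumption \<open>nondegenerate\<close> yields the independence of consecutive
  vectors. Since potentials are determined only up to a left constant for each index, the law for
  \<open>r (k + K)\<close> carries a constant \<open>c\<close>; it becomes exact for
  \<open>\<rho>\<close>. The nonlinear equations and the \<open>psi\<close> system involve only
  \<open>r 1\<close> to \<open>r K\<close>, where \<open>\<rho>\<close> and \<open>r\<close>
  agree.\<close>

theorem mainTheorem5:
  fixes \<Phi> :: "int ^ ('n::finite option) \<Rightarrow> ('d::division_ring ^ 'm::finite) set"
    and \<phi> :: "int \<Rightarrow> int ^ 'n \<Rightarrow> 'd ^ 'm"
    and u :: "'n \<Rightarrow> int \<Rightarrow> int ^ 'n \<Rightarrow> 'd"
    and r :: "int \<Rightarrow> int ^ 'n \<Rightarrow> 'd"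
    and K :: int
  assumes desargues: "desargues_map \<Phi>"
    and nondegenerate: "\<And>n k. \<Phi> (with_last n (k + 1)) \<noteq> \<Phi> (with_last n k)"
    and coords: "\<And>n k. homogeneous_coords (\<phi> k n) (\<Phi> (with_last n k))"
    and gauge: "\<And>i k n. \<phi> (k + 1) n - shift i (\<phi> k) n = \<phi> k n \<cdot>\<^sub>r u i k n"
    and compat_mult: "\<And>i j k n. i \<noteq> j \<Longrightarrow>
      u j k n * shift j (u i k) n = u i k n * shift i (u j k) n"
    and compat_add: "\<And>i j k n. i \<noteq> j \<Longrightarrow>
      shift j (u i k) n + u j (k + 1) n = shift i (u j k) n + u i (k + 1) n"
    and pot: "potentials u r"
    and K_pos: "K \<ge> 1"
    and periodic: "\<And>n k. \<Phi> (with_last n (k + K)) = \<Phi> (with_last n k)"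
  shows "(\<exists>\<mu>. monodromy_factors K \<phi> \<mu>) \<and>
    (\<forall>\<mu>. monodromy_factors K \<phi> \<mu> \<longrightarrow>
      (\<forall>i k n. \<mu> (k + 1) n = shift i (\<mu> k) n) \<and>
      (\<forall>i k n. u i (k + K) n = inverse (\<mu> k n) * u i k n * shift i (\<mu> k) n) \<and>
      (\<forall>k. \<exists>c. c \<noteq> 0 \<and> (\<forall>n. r (k + K) n = c * r k n * \<mu> k n)) \<and>
      (\<exists>\<rho>. potentials u \<rho> \<and> (\<forall>k\<in>{1..K}. \<rho> k = r k) \<and>
        (\<forall>k n. \<rho> (k + K) n = \<rho> k n * \<mu> k n)) \<and>
      (\<forall>i n. \<forall>b\<in>{1..K}.
        shift i (\<phi> b) n =
          row_mult K (\<lambda>a. \<phi> a n) (phi_matrix K (\<lambda>k. u i k n) (\<mu> 1 n)) b) \<and>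
      (\<exists>g. (\<forall>n. \<mu> 1 n = g (coord_sum n)) \<and>
        (\<forall>i j n. i \<noteq> j \<longrightarrow>
          (\<forall>k\<in>{1..K - 1}.
            (inverse (shift j (r k) n) - inverse (shift i (r k) n)) * shift j (shift i (r k)) n =
              inverse (r (k + 1) n) * (shift i (r (k + 1)) n - shift j (r (k + 1)) n)) \<and>
          (inverse (shift j (r K) n) - inverse (shift i (r K) n)) * shift j (shift i (r K)) n =
            inverse (g (coord_sum n)) * inverse (r 1 n) *
              (shift i (r 1) n - shift j (r 1) n) * g (coord_sum n + 1))) \<and>
      (\<forall>c\<in>ring_center. (\<forall>n. \<mu> 1 n = c) \<longrightarrow>
        (\<forall>i j n. i \<noteq> j \<longrightarrow> (\<forall>k\<in>{1..K}.
          (inverse (shift j (r k) n) - inverse (shift i (r k) n)) * shift j (shift i (r k)) n =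
            inverse (r (cyc_next K k) n) *
              (shift i (r (cyc_next K k)) n - shift j (r (cyc_next K k)) n))) \<and>
        (\<forall>l\<in>ring_center. c = (- l) powi K \<longrightarrow>
          (\<forall>i n. \<forall>b\<in>{1..K}.
            shift i (psi l \<phi> r b) n =
              row_mult K (\<lambda>a. psi l \<phi> r a n)
                (psi_matrix K l (\<lambda>k. r k n) (\<lambda>k. shift i (r k) n)) b))))"
proof -

  \<comment> \<open>Facts that do not depend on the choice of monodromy factors\<close>
  have nz: "\<phi> k n \<noteq> 0" for k n
    using coords[of k n] by (simp add: homogeneous_coords_def)
  have indep: "proj_point (\<phi> (k + 1) n) \<noteq> proj_point (\<phi> k n)" for k n
    using coords[of k n] coords[of "k + 1" n] nondegenerate[where n = n and k = k]
    by (simp add: homogeneous_coords_def)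
  have rnz: "r k n \<noteq> 0" and ur: "u i k n = inverse (r k n) * shift i (r k) n" for i k n
    using pot by (auto simp: potentials_def)
  have multiples: "\<exists>\<nu>. monodromy_factors (m * K) \<phi> \<nu>" for m
    using coords periodic_multiple[where f = "\<lambda>k. \<Phi> (with_last _ k)", OF periodic]
    by (rule monodromy_factors_exist)
  have potential_eq:
    "(inverse (shift j (r k) n) - inverse (shift i (r k) n)) * shift j (shift i (r k)) n =
      u i (k + 1) n - u j (k + 1) n" if "i \<noteq> j" for i j k n
    by (rule potential_equation[OF pot compat_add[OF that]])
  \<comment> \<open>At \<open>k = K\<close> this contains \<open>r (K + 1)\<close> instead of
    \<open>r 1\<close>; closing the system there takes the monodromy rule for
    \<open>u\<close>.\<close>
  have interior_eq:
    "(inverse (shift j (r k) n) - inverse (shift i (r k) n)) * shift j (shift i (r k)) n =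
      inverse (r (k + 1) n) * (shift i (r (k + 1)) n - shift j (r (k + 1)) n)"
    if "i \<noteq> j" for i j k n
    by (simp add: potential_eq[OF that] ur right_diff_distrib)
  have factors_exist: "\<exists>\<mu>. monodromy_factors K \<phi> \<mu>"
    using multiples[of 1] by simp
  show ?thesis
  proof (rule conjI[OF factors_exist], rule allI, rule impI, goal_cases)
    case mono: (1 \<mu>)
    have \<mu>nz: "\<mu> k n \<noteq> 0" and \<mu>: "\<phi> (k + K) n = \<phi> k n \<cdot>\<^sub>r \<mu> k n" for k n
      using mono by (auto simp: monodromy_factors_def)
    note rules = monodromy_rules[where u = u, OF nz indep gauge mono]

    \<comment> \<open>Passage around one period\<close>
    have \<phi>_wrap: "\<phi> (K + 1) n = \<phi> 1 n \<cdot>\<^sub>r \<mu> 1 n" for n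
      using \<mu>[of 1 n] by (simp add: add.commute)
    have u_wrap: "u i (K + 1) n = inverse (\<mu> 1 n) * u i 1 n * shift i (\<mu> 1) n" for i n
      using rules(2)[of i 1 n] by (simp add: add.commute)
    have potentials_shift: "\<exists>c. c \<noteq> 0 \<and> (\<forall>n. r (k + K) n = c * r k n * \<mu> k n)" for k
    proof -
      \<comment> \<open>\<open>r (k + K)\<close> and the product of \<open>r k\<close> and
        \<open>\<mu> k\<close> are potentials of the same functions
        \<open>u i (k + K)\<close>.\<close>
      have "inverse (r (k + K) n) * shift i (r (k + K)) n =
          inverse (r k n * \<mu> k n) * shift i (\<lambda>n. r k n * \<mu> k n) n" for i n
        using rules(2)[of i k n] rnz[of k n] \<mu>nz[of k n]
        by (simp add: ur shift_def nonzero_inverse_mult_distrib mult.assoc)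
      from potentials_unique[OF rnz _ this] rnz \<mu>nz show ?thesis
        by (simp add: mult.assoc)
    qed
    have rho: "\<exists>\<rho>. potentials u \<rho> \<and> (\<forall>k\<in>{1..K}. \<rho> k = r k) \<and>
        (\<forall>k n. \<rho> (k + K) n = \<rho> k n * \<mu> k n)"
      using quasi_periodic_potentials[where u = u, OF nz indep gauge pot mono multiples K_pos]
      by metis
    have linear: "shift i (\<phi> b) n =
        row_mult K (\<lambda>a. \<phi> a n) (phi_matrix K (\<lambda>k. u i k n) (\<mu> 1 n)) b"
      if "b \<in> {1..K}" for i n b
    proof -
      \<comment> \<open>Column \<open>b\<close> is the gauge relation solved for the translate; in
        the last column \<open>\<phi>_wrap\<close> produces the corner entry.\<close>
      have "shift i (\<phi> b) n = \<phi> (b + 1) n - \<phi> b n \<cdot>\<^sub>r u i b n"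
        using gauge[of b n i] by (simp add: algebra_simps)
      moreover have "row_mult K (\<lambda>a. \<phi> a n) (phi_matrix K (\<lambda>k. u i k n) (\<mu> 1 n)) b =
          \<phi> b n \<cdot>\<^sub>r (- u i b n) + (if b = K then \<phi> 1 n \<cdot>\<^sub>r \<mu> 1 n else \<phi> (b + 1) n \<cdot>\<^sub>r 1)"
        unfolding phi_matrix_def
        by (rule row_mult_cyclic[OF that, of "\<lambda>a. \<phi> a n" "\<lambda>b. - u i b n" "\<lambda>_ _. 1"])
      ultimately show ?thesis
        by (simp add: rscale_minus_right \<phi>_wrap)
    qed
    \<comment> \<open>Walking from \<open>n\<close> to the origin turns \<open>\<mu> 1\<close> into
      the factor with index \<open>1 + coord_sum n\<close>.\<close>
    define g where "g s = \<mu> (1 + s) 0" for s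
    have g: "\<mu> 1 n = g (coord_sum n)" for n
      unfolding g_def using rules(1) by (intro lattice_walk) (simp add: shift_def)
    \<comment> \<open>\<open>u_wrap\<close> expresses \<open>u i (K + 1)\<close> through
      \<open>u i 1\<close>. All translates of \<open>\<mu> 1\<close> equal
      \<open>g (coord_sum n + 1)\<close>, whatever the direction, so this factor comes out on the
      right.\<close>
    have wrap_eq:
      "(inverse (shift j (r K) n) - inverse (shift i (r K) n)) * shift j (shift i (r K)) n =
        inverse (g (coord_sum n)) * inverse (r 1 n) *
          (shift i (r 1) n - shift j (r 1) n) * g (coord_sum n + 1)"
      if "i \<noteq> j" for i j n
      by (simp add: potential_eq[OF that] u_wrap)
        (simp add: g ur shift_def coord_sum_axis algebra_simps)

    \<comment> \<open>Constant central monodromy\<close>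
    have central_eq:
      "(inverse (shift j (r k) n) - inverse (shift i (r k) n)) * shift j (shift i (r k)) n =
        inverse (r (cyc_next K k) n) *
          (shift i (r (cyc_next K k)) n - shift j (r (cyc_next K k)) n)"
      if "c \<in> ring_center" "\<And>n. \<mu> 1 n = c" "i \<noteq> j" for c i j k n
    proof (cases "k = K")
      case True
      \<comment> \<open>Conjugation by a nonzero central element is trivial, so \<open>u\<close> is
        the same at \<open>K + 1\<close> as at 1.\<close>
      have "inverse c * x * c = x" for x
        using \<mu>nz[of 1 n] that(2) ring_centerD[OF that(1)]
        by (simp add: mult.assoc) (simp add: mult.assoc[symmetric])
      then have "u i (K + 1) n = u i 1 n" for i
        by (simp add: u_wrap that(2) shift_def)
      then show ?thesis
        using True by (simp add: cyc_next_def potential_eq[OF that(3)])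
          (simp add: ur right_diff_distrib)
    next
      case False
      then show ?thesis
        using interior_eq[OF that(3)] by (simp add: cyc_next_def)
    qed
    have psi_linear: "shift i (psi l \<phi> r b) n =
        row_mult K (\<lambda>a. psi l \<phi> r a n)
          (psi_matrix K l (\<lambda>k. r k n) (\<lambda>k. shift i (r k) n)) b"
      if c: "c \<in> ring_center" "\<And>n. \<mu> 1 n = c" and l: "l \<in> ring_center" "c = (- l) powi K"
        and b: "b \<in> {1..K}" for c l i n b
    proof -
      \<comment> \<open>Otherwise \<open>(- l) powi K\<close> would vanish, as \<open>K\<close> is
        positive, while monodromy factors do not.\<close>
      have "l \<noteq> 0"
        using c(2)[of n] \<mu>nz[of 1 n] l(2) K_pos by auto
      have snz: "shift i (r k) n \<noteq> 0" for k
        using rnz by (simp add: shift_def)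
      define s where "s = ((- 1) powi coord_sum n :: 'd)"
      \<comment> \<open>The factor \<open>r a n\<close> of the matrix entry cancels the inverse
        inside \<open>psi\<close> once the central \<open>l\<close> has been moved aside; what
        remains has the shape of the last term of \<open>psi_shift\<close>.\<close>
      have psi_r: "psi l \<phi> r a n \<cdot>\<^sub>r (l * r a n * x) = (((- l) powi (- a) * s) *s \<phi> a n) \<cdot>\<^sub>r (l * x)"
        for a x
        using ring_centerD[OF l(1), symmetric] rnz[of a n]
        by (simp add: psi_def s_def smult_rscale rscale_rscale mult.assoc)
          (simp add: mult.assoc[symmetric])
      have "shift i (psi l \<phi> r b) n = psi l \<phi> r b n +
          (((- l) powi (- (b + 1)) * s) *s \<phi> (b + 1) n) \<cdot>\<^sub>r (l * inverse (shift i (r b) n))"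
        unfolding s_def using gauge[of b n i]
        by (intro psi_shift[OF \<open>l \<noteq> 0\<close> l(1) snz]) (simp add: ur)
      \<comment> \<open>The choice \<open>c = (- l) powi K\<close> is made for this: the monodromy
        raises the exponent \<open>- (K + 1)\<close> to \<open>- 1\<close>, the weight of
        \<open>psi\<close> at index 1.\<close>
      moreover have "((- l) powi (- (K + 1)) * s) *s \<phi> (K + 1) n = ((- l) powi (- 1) * s) *s \<phi> 1 n"
      proof -
        have "(- l) powi (- 1) = (- l) powi (- (K + 1)) * c"
          using power_int_add[of "- l" "- (K + 1)" K] \<open>l \<noteq> 0\<close> l(2) by simp
        then show ?thesis
          using ring_centerD[OF c(1)]
          by (simp add: \<phi>_wrap c(2) smult_center[OF c(1), symmetric] mult.assoc)
      qed
      moreover have "row_mult K (\<lambda>a. psi l \<phi> r a n)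
          (psi_matrix K l (\<lambda>k. r k n) (\<lambda>k. shift i (r k) n)) b =
          psi l \<phi> r b n \<cdot>\<^sub>r 1 +
          (if b = K then psi l \<phi> r 1 n \<cdot>\<^sub>r (l * r 1 n * inverse (shift i (r K) n))
           else psi l \<phi> r (b + 1) n \<cdot>\<^sub>r (l * r (b + 1) n * inverse (shift i (r b) n)))"
        unfolding psi_matrix_def
        by (rule row_mult_cyclic[OF b, of "\<lambda>a. psi l \<phi> r a n" "\<lambda>_. 1"
              "\<lambda>a b. l * r a n * inverse (shift i (r b) n)"])
      ultimately show ?thesis
        by (simp add: psi_r)
    qed
    show ?case
      by (intro conjI allI ballI impI exI[of _ g])
        (rule rules(1) rules(2) potentials_shift rho g
          | rule linear interior_eq wrap_eq, assumption
          | rule central_eq psi_linear, assumption, erule spec, assumption+)+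
  qed
qed

end
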